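(* Let $l\ge 2$ and let $\tau=\underbrace{11\cdots1}_{l-1}2\in[2]^l$ be a subword pattern. Then for every $k\ge 0$, \[ F_\tau(x,y;k)=\frac{1-y}{1-x^{2-l}-y+x^{2-l}\bigl(1-x^{l-1}(1-y)\bigr)^k}. \]
   Context: For a positive integer $k$, $[k]=\{1,\dots,k\}$ and $[k]^n$ is the set of words (strings) of length $n$ over $[k]$; $[0]^n$ is empty for $n\ge1$ and $[0]^0$ contains only the empty word. A subword pattern is a word $\tau=\tau_1\cdots\tau_l\in[m]^l$ containing every letter of $[m]$. An occurrence of $\tau$ in a word $\sigma=\sigma_1\cdots\sigma_n$ is an index $i$ with $1\le i\le n-l+1$ such that the consecutive factor $\sigma_i\sigma_{i+1}\cdots\sigma_{i+l-1}$ is order-isomorphic to $\tau$, i.e. for all $s,t$: $\sigma_{i+s-1}<\sigma_{i+t-1}$ iff $\tau_s<\tau_t$, and $\sigma_{i+s-1}=\sigma_{i+t-1}$ iff $\tau_s=\tau_t$. Let $\sigma(\tau)$ be the number of occurrences of $\tau$ in $\sigma$. Define the formal power series $F_\tau(x,y;k)=\sum_{n\ge0}\sum_{\sigma\in[k]^n}x^n y^{\sigma(\tau)}$. *)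

theory Defs
  imports "HOL-Computational_Algebra.Computational_Algebra"
begin

definition words :: "nat \<Rightarrow> nat \<Rightarrow> nat list set" where
  "words k n = {\<sigma>. length \<sigma> = n \<and> set \<sigma> \<subseteq> {1..k}}"

definition subword_pattern :: "nat \<Rightarrow> nat \<Rightarrow> nat list \<Rightarrow> bool" where
  "subword_pattern m l \<tau> \<longleftrightarrow> \<tau> \<in> words m l \<and> {1..m} \<subseteq> set \<tau>"

definition order_isomorphic :: "nat list \<Rightarrow> nat list \<Rightarrow> bool" where
  "order_isomorphic u v \<longleftrightarrow> length u = length v \<and>
     (\<forall>s<length u. \<forall>t<length u.
        (u ! s < u ! t \<longleftrightarrow> v ! s < v ! t) \<and> (u ! s = u ! t \<longleftrightarrow> v ! s = v ! t))"

(* Positions are counted from 0, so i stands for the 1-based index i + 1. *)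
definition occurrences :: "nat list \<Rightarrow> nat list \<Rightarrow> nat set" where
  "occurrences \<tau> \<sigma> = {i. i + length \<tau> \<le> length \<sigma> \<and>
     order_isomorphic (take (length \<tau>) (drop i \<sigma>)) \<tau>}"

definition occ_count :: "nat list \<Rightarrow> nat list \<Rightarrow> nat" where
  "occ_count \<tau> \<sigma> = card (occurrences \<tau> \<sigma>)"

(* The series variable of the fps is x and the polynomial variable is y: for fixed n
   only finitely many powers of y occur, so the generating function lies in Z[y][[x]]. *)
definition F :: "nat list \<Rightarrow> nat \<Rightarrow> int poly fps" where
  "F \<tau> k = Abs_fps (\<lambda>n. \<Sum>\<sigma>\<in>words k n. monom 1 (occ_count \<tau> \<sigma>))"

(* Closed forms with negative powers of x and with denominators divisible by 1 - y make
   sense in the field Q(y)((x)), where Q(y) is the fraction field of Z[y]. *)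
type_synonym laurent = "int poly fract fls"

definition to_laurent :: "int poly fps \<Rightarrow> laurent" where
  "to_laurent f = fps_to_fls (Abs_fps (\<lambda>n. to_fract (fps_nth f n)))"

definition X :: laurent where
  "X = fls_X"

definition Y :: laurent where
  "Y = fls_const (to_fract (monom 1 1))"

lemma to_laurent_inj: "to_laurent f = to_laurent g \<longleftrightarrow> f = g"
  unfolding to_laurent_def by (auto simp: fps_eq_iff)

lemma subword_pattern_ones_two:
  assumes "l \<ge> 2"
  shows "subword_pattern 2 l (replicate (l - 1) 1 @ [2])"
  using assms by (auto simp: subword_pattern_def words_def)

end

theory Submission
  imports Defs
begin

text \<open>
  Write \<open>l = m + 1\<close>, let \<open>F\<close> be the generating function of all words over \<open>[k]\<close> and \<open>S a\<close> that of
  the nonempty words whose first letter is at least \<open>a\<close>. Prepending \<open>a\<close> to a word \<open>w\<close> creates a new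
  occurrence of the pattern exactly when \<open>w\<close> starts with \<open>m - 1\<close> letters \<open>a\<close> followed by a letter
  \<open>b > a\<close>, and those \<open>m - 1\<close> letters carry no occurrence themselves. Hence the words starting with
  \<open>a\<close> contribute \<open>x F - (1 - y) x\<^sup>m S (a + 1)\<close>, so \<open>S a = x F + q S (a + 1)\<close> with
  \<open>q = 1 - x\<^sup>m (1 - y)\<close>. As \<open>S (k + 1) = 0\<close> and \<open>S 1 = F - 1\<close>, this gives
  \<open>F - 1 = x F (1 + q + \<dots> + q\<^bsup>k-1\<^esup>)\<close>.
\<close>

section \<open>Occurrences of the pattern\<close>

lemma order_isomorphic_ones_two_iff:
  assumes "m \<ge> 1"
  shows "order_isomorphic u (replicate m 1 @ [2]) \<longleftrightarrow> (\<exists>a b. a < b \<and> u = replicate m a @ [b])"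
proof
  assume iso: "order_isomorphic u (replicate m 1 @ [2])"
  then have len: "length u = Suc m"
    by (simp add: order_isomorphic_def)
  define a where "a = u ! 0"
  \<comment> \<open>Comparing every position with position 0 already determines \<open>u\<close> up
    to the values \<open>a\<close> and \<open>u ! m\<close>.\<close>
  have eq: "u ! s = a" if "s < m" for s
    unfolding a_def using iso assms that unfolding order_isomorphic_def by (auto simp: nth_append len)
  have less: "a < u ! m"
    unfolding a_def using iso assms unfolding order_isomorphic_def by (auto simp: nth_append len)
  have "u = replicate m a @ [u ! m]"
    by (rule nth_equalityI) (auto simp: len nth_append less_Suc_eq eq)
  with less show "\<exists>a b. a < b \<and> u = replicate m a @ [b]"
    by blast
next
  assume "\<exists>a b. a < b \<and> u = replicate m a @ [b]"
  then obtain a b where "a < b" and u: "u = replicate m a @ [b]"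
    by blast
  moreover have "(replicate m c @ [d]) ! s = (if s < m then c else d)"
    if "s < Suc m" for c d s :: nat
    using that by (auto simp: nth_append less_Suc_eq)
  ultimately show "order_isomorphic u (replicate m 1 @ [2])"
    by (simp add: order_isomorphic_def)
qed

lemma take_eq_replicate_snoc_iff:
  "Suc m \<le> length w \<and> take (Suc m) w = replicate m a @ [b]
     \<longleftrightarrow> (\<exists>v. w = replicate m a @ b # v)"
proof
  assume "Suc m \<le> length w \<and> take (Suc m) w = replicate m a @ [b]"
  then have "w = (replicate m a @ [b]) @ drop (Suc m) w"
    by (metis append_take_drop_id)
  then show "\<exists>v. w = replicate m a @ b # v"
    by auto
qed auto

lemma zero_in_occurrences_iff:
  assumes "m \<ge> 1"
  shows "0 \<in> occurrences (replicate m 1 @ [2]) w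
     \<longleftrightarrow> (\<exists>a b v. a < b \<and> w = replicate m a @ b # v)"
proof -
  have "0 \<in> occurrences (replicate m 1 @ [2]) w \<longleftrightarrow>
      Suc m \<le> length w \<and> (\<exists>a b. a < b \<and> take (Suc m) w = replicate m a @ [b])"
    using order_isomorphic_ones_two_iff[OF assms, of "take (Suc m) w"]
    by (simp add: occurrences_def)
  then show ?thesis
    using take_eq_replicate_snoc_iff[of m w] by blast
qed

lemma finite_occurrences: "finite (occurrences \<tau> w)"
  by (rule finite_subset[of _ "{..length w}"]) (auto simp: occurrences_def)

lemma occ_count_Cons:
  "occ_count \<tau> (a # w) = occ_count \<tau> w + (if 0 \<in> occurrences \<tau> (a # w) then 1 else 0)"
proof -
  have suc: "Suc i \<in> occurrences \<tau> (a # w) \<longleftrightarrow> i \<in> occurrences \<tau> w" for i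
    by (auto simp: occurrences_def)
  have "occurrences \<tau> (a # w) =
      Suc ` occurrences \<tau> w \<union> (if 0 \<in> occurrences \<tau> (a # w) then {0} else {})"
    (is "?L = ?R")
  proof (rule set_eqI)
    show "i \<in> ?L \<longleftrightarrow> i \<in> ?R" for i
      by (cases i) (auto simp: suc)
  qed
  then have "occ_count \<tau> (a # w) =
      card (Suc ` occurrences \<tau> w \<union> (if 0 \<in> occurrences \<tau> (a # w) then {0} else {}))"
    unfolding occ_count_def by (rule arg_cong)
  also have "\<dots> = occ_count \<tau> w + (if 0 \<in> occurrences \<tau> (a # w) then 1 else 0)"
    by (simp add: occ_count_def card_image finite_occurrences)
  finally show ?thesis .
qed

text \<open>A run of \<open>a\<close> shorter than \<open>m\<close> that is stopped by a different
  letter cannot begin an occurrence, so its letters can be stripped one at a time.\<close>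

lemma occ_count_replicate_append:
  assumes "j < m" and "a \<noteq> b"
  shows "occ_count (replicate m 1 @ [2]) (replicate j a @ b # v)
     = occ_count (replicate m 1 @ [2]) (b # v)"
  using assms(1)
proof (induction j)
  case (Suc j)
  have "0 \<notin> occurrences (replicate m 1 @ [2]) (replicate (Suc j) a @ b # v)"
  proof
    assume "0 \<in> occurrences (replicate m 1 @ [2]) (replicate (Suc j) a @ b # v)"
    then obtain c d u where eq: "replicate (Suc j) a @ b # v = replicate m c @ d # u"
      using zero_in_occurrences_iff[of m "replicate (Suc j) a @ b # v"] Suc.prems by auto
    \<comment> \<open>Since \<open>Suc j < m\<close>, positions 0 and \<open>Suc j\<close> both lie
      in the run of \<open>c\<close>.\<close>
    have "a = c"
      using arg_cong[OF eq, of "\<lambda>w. w ! 0"] Suc.prems by (simp add: nth_append)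
    moreover have "b = c"
      using arg_cong[OF eq, of "\<lambda>w. w ! Suc j"] Suc.prems by (simp add: nth_append)
    ultimately show False
      using assms(2) by simp
  qed
  then show ?case
    using Suc by (simp add: occ_count_Cons)
qed simp

lemma occ_count_Cons_ones_two:
  assumes "m \<ge> 1"
  shows "occ_count (replicate m 1 @ [2]) (a # w) = occ_count (replicate m 1 @ [2]) w
     + (if \<exists>b v. a < b \<and> w = replicate (m - 1) a @ b # v then 1 else 0)"
proof -
  obtain j where m: "m = Suc j"
    using assms by (cases m) auto
  have "0 \<in> occurrences (replicate m 1 @ [2]) (a # w)
      \<longleftrightarrow> (\<exists>b v. a < b \<and> w = replicate (m - 1) a @ b # v)"
    unfolding zero_in_occurrences_iff[OF assms] by (auto simp: m)
  then show ?thesis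
    by (simp add: occ_count_Cons)
qed

section \<open>Generating functions of weighted sets of words\<close>

text \<open>The weight is a parameter so that prepending letters becomes a change of weight on the
  same set. Sums over infinite sets default to 0, hence the finiteness hypotheses below.\<close>

definition gen_fun :: "('a list \<Rightarrow> 'r) \<Rightarrow> 'a list set \<Rightarrow> 'r :: comm_ring_1 fps" where
  "gen_fun wt A = Abs_fps (\<lambda>n. \<Sum>w\<in>{w \<in> A. length w = n}. wt w)"

lemma gen_fun_empty [simp]: "gen_fun wt {} = 0"
  by (simp add: gen_fun_def fps_eq_iff)

lemma gen_fun_cong: "(\<And>w. w \<in> A \<Longrightarrow> wt w = wt' w) \<Longrightarrow> gen_fun wt A = gen_fun wt' A"
  by (simp add: gen_fun_def fps_eq_iff)

lemma gen_fun_add: "gen_fun (\<lambda>w. wt w + wt' w) A = gen_fun wt A + gen_fun wt' A"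
  by (simp add: gen_fun_def fps_eq_iff sum.distrib)

lemma gen_fun_scale: "gen_fun (\<lambda>w. c * wt w) A = fps_const c * gen_fun wt A"
  by (simp add: gen_fun_def fps_eq_iff sum_distrib_left)

lemma gen_fun_Un:
  assumes "\<And>n. finite {w \<in> A \<union> B. length w = n}" and "A \<inter> B = {}"
  shows "gen_fun wt (A \<union> B) = gen_fun wt A + gen_fun wt B"
proof (rule fps_ext)
  fix n
  have "{w \<in> A \<union> B. length w = n} = {w \<in> A. length w = n} \<union> {w \<in> B. length w = n}"
    by auto
  with assms(1)[of n] assms(2)
  show "fps_nth (gen_fun wt (A \<union> B)) n = fps_nth (gen_fun wt A + gen_fun wt B) n"
    by (auto simp: gen_fun_def intro!: sum.union_disjoint)
qed

lemma gen_fun_restrict: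
  assumes "\<And>n. finite {w \<in> A. length w = n}" and "B \<subseteq> A"
  shows "gen_fun (\<lambda>w. if w \<in> B then wt w else 0) A = gen_fun wt B"
proof (rule fps_ext)
  fix n
  have "{w \<in> B. length w = n} = {w \<in> A. length w = n} \<inter> B"
    using assms(2) by auto
  with assms(1)[of n]
  show "fps_nth (gen_fun (\<lambda>w. if w \<in> B then wt w else 0) A) n = fps_nth (gen_fun wt B) n"
    by (simp add: gen_fun_def sum.inter_restrict)
qed

lemma gen_fun_append:
  "gen_fun wt ((@) u ` A) = fps_X ^ length u * gen_fun (\<lambda>w. wt (u @ w)) A"
proof (rule fps_ext)
  fix n
  have "{w \<in> (@) u ` A. length w = n} =
      (if n < length u then {} else (@) u ` {w \<in> A. length w = n - length u})"
    by auto
  moreover have "inj_on ((@) u) B" for B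
    by (simp add: inj_on_def)
  ultimately show "fps_nth (gen_fun wt ((@) u ` A)) n =
      fps_nth (fps_X ^ length u * gen_fun (\<lambda>w. wt (u @ w)) A) n"
    by (auto simp: gen_fun_def fps_X_power_mult_nth sum.reindex)
qed

section \<open>The recurrence on the first letter\<close>

text \<open>\<open>gen_fun\<close> of this set is the series \<open>S a\<close> of the overview. A
  lower bound on the first letter, instead of a fixed one, captures all letters that may end a run
  of smaller ones.\<close>

definition first_ge :: "nat \<Rightarrow> nat \<Rightarrow> nat list set" where
  "first_ge k a = {b # v | b v. a \<le> b \<and> b # v \<in> lists {1..k}}"

lemma finite_lists_length: "A \<subseteq> lists {1..k::nat} \<Longrightarrow> finite {w \<in> A. length w = n}"
  by (rule finite_subset[OF _ finite_lists_length_eq[of "{1..k}" n]]) auto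

lemma F_eq_gen_fun: "F \<tau> k = gen_fun (\<lambda>w. monom 1 (occ_count \<tau> w)) (lists {1..k})"
  by (auto simp: F_def gen_fun_def words_def fps_eq_iff lists_eq_set intro!: sum.cong)

lemma gen_fun_first_letter:
  assumes "m \<ge> 1" and "a \<in> {1..k}"
  defines "wt \<equiv> \<lambda>w. monom (1 :: int) (occ_count (replicate m 1 @ [2]) w)"
  shows "gen_fun wt ((@) [a] ` lists {1..k}) = fps_X * gen_fun wt (lists {1..k})
     + fps_const (monom 1 1 - 1) * fps_X ^ m * gen_fun wt (first_ge k (Suc a))"
proof -
  let ?W = "lists {1..k}"
  \<comment> \<open>These are the words that gain an occurrence when \<open>a\<close> is
    prepended.\<close>
  let ?T = "(@) (replicate (m - 1) a) ` first_ge k (Suc a)"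
  have T_iff: "w \<in> ?T \<longleftrightarrow> (\<exists>b v. a < b \<and> w = replicate (m - 1) a @ b # v)" if "w \<in> ?W" for w
    using that by (fastforce simp: first_ge_def)
  have T_sub: "?T \<subseteq> ?W"
    using assms(2) by (auto simp: first_ge_def)
  \<comment> \<open>On \<open>?T\<close> the weight is multiplied by y, and y times
    \<open>wt w\<close> is \<open>wt w\<close> plus (y - 1) times \<open>wt w\<close>.\<close>
  have step: "wt ([a] @ w) = wt w + (monom 1 1 - 1) * (if w \<in> ?T then wt w else 0)"
    if "w \<in> ?W" for w
  proof -
    have "occ_count (replicate m 1 @ [2]) ([a] @ w)
        = occ_count (replicate m 1 @ [2]) w + (if w \<in> ?T then 1 else 0)"
      unfolding T_iff[OF that] using occ_count_Cons_ones_two[OF assms(1), of a w] by simp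
    then show ?thesis
      by (simp add: wt_def algebra_simps mult_monom)
  qed
  have wt_T: "wt (replicate (m - 1) a @ w) = wt w" if "w \<in> first_ge k (Suc a)" for w
  proof -
    from that obtain b v where "w = b # v" "a \<noteq> b"
      by (auto simp: first_ge_def)
    then show ?thesis
      using occ_count_replicate_append[of "m - 1" m a b v] assms(1) by (simp add: wt_def)
  qed
  have "gen_fun wt ?T = fps_X ^ (m - 1) * gen_fun wt (first_ge k (Suc a))"
    using gen_fun_cong[of "first_ge k (Suc a)", OF wt_T] by (simp add: gen_fun_append)
  moreover have "gen_fun wt ((@) [a] ` ?W) = fps_X *
      (gen_fun wt ?W + fps_const (monom 1 1 - 1) * gen_fun wt ?T)"
  proof -
    have "gen_fun wt ((@) [a] ` ?W) = fps_X * gen_fun (\<lambda>w. wt ([a] @ w)) ?W"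
      using gen_fun_append[of wt "[a]" ?W] by simp
    also have "gen_fun (\<lambda>w. wt ([a] @ w)) ?W = gen_fun wt ?W
        + fps_const (monom 1 1 - 1) * gen_fun (\<lambda>w. if w \<in> ?T then wt w else 0) ?W"
      unfolding gen_fun_scale[symmetric] gen_fun_add[symmetric]
      by (rule gen_fun_cong) (rule step)
    also have "gen_fun (\<lambda>w. if w \<in> ?T then wt w else 0) ?W = gen_fun wt ?T"
      by (rule gen_fun_restrict[OF finite_lists_length[OF subset_refl] T_sub])
    finally show ?thesis .
  qed
  moreover have "fps_X ^ m = fps_X * (fps_X ^ (m - 1) :: int poly fps)"
    using assms(1) by (cases m) auto
  ultimately show ?thesis
    by (simp add: algebra_simps)
qed

text \<open>The first letter is either \<open>a\<close> or at least \<open>Suc a\<close>. The second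
  case and the correction term of the first are both multiples of the series for
  \<open>Suc a\<close>, which gives the factor q.\<close>

lemma gen_fun_first_ge_step:
  assumes "m \<ge> 1" and "a \<in> {1..k}"
  defines "wt \<equiv> \<lambda>w. monom (1 :: int) (occ_count (replicate m 1 @ [2]) w)"
  shows "gen_fun wt (first_ge k a) = fps_X * gen_fun wt (lists {1..k})
     + (1 - fps_X ^ m * (1 - fps_const (monom 1 1))) * gen_fun wt (first_ge k (Suc a))"
proof -
  have split: "first_ge k a = (@) [a] ` lists {1..k} \<union> first_ge k (Suc a)"
    using assms(2) by (auto simp: first_ge_def image_iff Suc_le_eq)
  have "gen_fun wt (first_ge k a)
      = gen_fun wt ((@) [a] ` lists {1..k}) + gen_fun wt (first_ge k (Suc a))"
    unfolding split
  proof (rule gen_fun_Un)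
    show "finite {w \<in> (@) [a] ` lists {1..k} \<union> first_ge k (Suc a). length w = n}" for n
      by (rule finite_lists_length[of _ k]) (use assms(2) in \<open>auto simp: first_ge_def\<close>)
  qed (auto simp: first_ge_def)
  then show ?thesis
    using gen_fun_first_letter[OF assms(1,2)]
    by (simp add: wt_def algebra_simps flip: fps_const_sub)
qed

text \<open>The recurrence is unrolled downwards from \<open>Suc k\<close>, where no word is left;
  \<open>j\<close> counts the letters that are allowed at the front.\<close>

lemma gen_fun_first_ge_closed:
  assumes "m \<ge> 1" and "j \<le> k"
  defines "wt \<equiv> \<lambda>w. monom (1 :: int) (occ_count (replicate m 1 @ [2]) w)"
  shows "gen_fun wt (first_ge k (Suc (k - j))) = fps_X * gen_fun wt (lists {1..k})
     * (\<Sum>i<j. (1 - fps_X ^ m * (1 - fps_const (monom 1 1))) ^ i)"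
  using assms(2)
proof (induction j)
  case 0
  have "first_ge k (Suc k) = {}"
    by (auto simp: first_ge_def)
  then show ?case
    by simp
next
  case (Suc j)
  then have "Suc (k - Suc j) = k - j" and "k - j \<in> {1..k}"
    by auto
  with Suc gen_fun_first_ge_step[OF assms(1), of "k - j" k] show ?case
    \<comment> \<open>The recurrence multiplies the old sum by q, so the new term is the one at
      index 0.\<close>
    unfolding wt_def sum.lessThan_Suc_shift
    by (simp add: algebra_simps sum_distrib_left sum_distrib_right)
qed

text \<open>The geometric sum stays unevaluated: its closed form would need division by x^m (1 - y),
  which is not a unit among power series over the integer polynomials.\<close>

lemma F_functional_equation:
  assumes "m \<ge> 1"
  shows "F (replicate m 1 @ [2]) k = 1 + fps_X * F (replicate m 1 @ [2]) k
     * (\<Sum>i<k. (1 - fps_X ^ m * (1 - fps_const (monom 1 1))) ^ i)"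
proof -
  let ?\<tau> = "replicate m 1 @ [2] :: nat list"
  let ?wt = "\<lambda>w. monom (1 :: int) (occ_count ?\<tau> w)"
  have split: "lists {1..k} = {[]} \<union> first_ge k 1"
  proof (rule set_eqI)
    show "w \<in> lists {1..k} \<longleftrightarrow> w \<in> {[]} \<union> first_ge k 1" for w
      by (cases w) (auto simp: first_ge_def)
  qed
  have "occ_count ?\<tau> [] = 0"
    by (simp add: occ_count_def occurrences_def)
  moreover have "{w :: nat list. w = [] \<and> length w = n} = (if n = 0 then {[]} else {})" for n
    by auto
  ultimately have Nil: "gen_fun ?wt {[]} = 1"
    by (simp add: gen_fun_def fps_eq_iff)
  have "F ?\<tau> k = gen_fun ?wt {[]} + gen_fun ?wt (first_ge k 1)"
    unfolding F_eq_gen_fun split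
  proof (rule gen_fun_Un)
    show "finite {w \<in> {[]} \<union> first_ge k 1. length w = n}" for n
      unfolding split[symmetric] by (rule finite_lists_length[OF subset_refl])
  qed (auto simp: first_ge_def)
  then show ?thesis
    using gen_fun_first_ge_closed[OF assms, of k k] Nil by (simp add: F_eq_gen_fun)
qed

section \<open>Transfer to Laurent series\<close>

text \<open>This and the next lemmas show that \<open>to_laurent\<close> is a ring homomorphism, so
  the functional equation carries over.\<close>

lemma to_laurent_add: "to_laurent (f + g) = to_laurent f + to_laurent g"
  unfolding to_laurent_def fps_to_fls_plus[symmetric]
  by (rule arg_cong[of _ _ fps_to_fls]) (simp add: fps_eq_iff)

lemma to_laurent_diff: "to_laurent (f - g) = to_laurent f - to_laurent g"
  by (metis to_laurent_add add_diff_cancel_right' diff_add_cancel)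

lemma to_laurent_mult: "to_laurent (f * g) = to_laurent f * to_laurent g"
  unfolding to_laurent_def fls_times_fps_to_fls[symmetric]
  by (simp add: fps_eq_iff fps_mult_nth)

lemma to_laurent_const: "to_laurent (fps_const c) = fls_const (to_fract c)"
proof -
  have "Abs_fps (\<lambda>n. to_fract (fps_nth (fps_const c) n)) = fps_const (to_fract c)"
    by (simp add: fps_eq_iff)
  then show ?thesis
    by (simp add: to_laurent_def)
qed

lemma to_laurent_0: "to_laurent 0 = 0"
  using to_laurent_const[of 0] by simp

lemma to_laurent_1: "to_laurent 1 = 1"
  using to_laurent_const[of 1] by simp

lemma to_laurent_X: "to_laurent fps_X = X"
proof -
  have "Abs_fps (\<lambda>n. to_fract (fps_nth (fps_X :: int poly fps) n)) = fps_X"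
    by (simp add: fps_eq_iff fps_X_def)
  then show ?thesis
    unfolding to_laurent_def X_def by (simp only: fps_X_to_fls)
qed

lemma to_laurent_power: "to_laurent (f ^ n) = to_laurent f ^ n"
  by (induction n) (simp_all add: to_laurent_1 to_laurent_mult)

lemma to_laurent_sum: "to_laurent (sum f A) = (\<Sum>x\<in>A. to_laurent (f x))"
  by (induction A rule: infinite_finite_induct) (simp_all add: to_laurent_0 to_laurent_add)

text \<open>The series times the denominator of the closed form is \<open>1 - Y\<close>, so this
  keeps that denominator from vanishing.\<close>

lemma Y_neq_1: "Y \<noteq> 1"
proof
  assume "Y = 1"
  then have "to_laurent (fps_const (monom 1 1)) = to_laurent (fps_const 1)"
    unfolding to_laurent_const Y_def[symmetric] by simp
  then have "monom 1 1 = (1 :: int poly)"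
    by (metis to_laurent_inj fps_nth_fps_const)
  then show False
    by (metis degree_1 degree_monom_eq one_neq_zero)
qed

theorem theorem2p2:
  fixes l k :: nat and \<tau> :: "nat list"
  assumes "l \<ge> 2"
    and "\<tau> = replicate (l - 1) 1 @ [2]"
  shows "to_laurent (F \<tau> k) =
    (1 - Y) /
    (1 - X powi (2 - int l) - Y + X powi (2 - int l) * (1 - X ^ (l - 1) * (1 - Y)) ^ k)"
proof -
  let ?f = "to_laurent (F \<tau> k)"
  define q where "q = 1 - X ^ (l - 1) * (1 - Y)"
  define p where "p = X powi (2 - int l)"
  let ?s = "\<Sum>i<k. q ^ i"
  have q: "to_laurent (1 - fps_X ^ (l - 1) * (1 - fps_const (monom 1 1))) = q"
    by (simp add: q_def to_laurent_diff to_laurent_mult to_laurent_power to_laurent_1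
        to_laurent_X to_laurent_const Y_def)
  have feq: "?f = 1 + X * ?f * ?s"
    using arg_cong[OF F_functional_equation[of "l - 1" k], of to_laurent] assms
    unfolding to_laurent_add to_laurent_mult to_laurent_sum to_laurent_power q
    unfolding to_laurent_1 to_laurent_X by simp
  have "X \<noteq> 0"
    by (simp add: X_def)
  then have "p * X ^ (l - 1) = X powi (2 - int l + int (l - 1))"
    unfolding p_def by (subst power_int_add) auto
  \<comment> \<open>As \<open>l \<ge> 2\<close>, the truncated \<open>l - 1\<close> is the true
    difference and the exponents add up to 1.\<close>
  then have pX: "p * X ^ (l - 1) = X"
    using assms(1) by simp
  \<comment> \<open>The geometric sum formula applies with
    \<open>1 - q = X ^ (l - 1) * (1 - Y)\<close>.\<close>
  have "p * (1 - q ^ k) = p * X ^ (l - 1) * (1 - Y) * ?s"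
    unfolding one_diff_power_eq by (simp add: q_def)
  then have geo: "p * (1 - q ^ k) = X * (1 - Y) * ?s"
    unfolding pX .
  have "?f * (1 - p - Y + p * q ^ k) = ?f * (1 - Y) - ?f * (p * (1 - q ^ k))"
    by (simp add: algebra_simps)
  also have "\<dots> = (?f - X * ?f * ?s) * (1 - Y)"
    unfolding geo by (simp add: algebra_simps)
  also have "?f - X * ?f * ?s = 1"
    using feq by (metis add_diff_cancel_right')
  finally have eq: "?f * (1 - p - Y + p * q ^ k) = 1 - Y"
    by simp
  moreover from this have "1 - p - Y + p * q ^ k \<noteq> 0"
    using Y_neq_1 by auto
  ultimately show ?thesis
    unfolding p_def[symmetric] q_def[symmetric] by (simp add: eq_divide_eq)
qed

end
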